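(* The multiple-conclusion Hilbert system $\mathsf{R}_{\mathrm{PWK}}$ below is $\{p,\neg p\}$-analytic, and $\rhd_{\mathsf{R}_{\mathrm{PWK}}} \;=\; \rhd_{\mathrm{PWK}}$.
   Context: $L$: formulas over a countably infinite set of variables with binary $\land,\lor$ and unary $\neg$. $\mathbf A$: algebra on $\{f,u,t\}$ where each connective acts classically on $\{f,t\}$-arguments and returns $u$ if any argument is $u$. Valuations: homomorphisms into $\mathbf A$. For $\Gamma,\Delta\subseteq L$, $\Gamma\rhd_{\mathrm{PWK}}\Delta$ iff there is no valuation $v$ with $v[\Gamma]\subseteq\{u,t\}$ and $v[\Delta]\subseteq\{f\}$. A Set-Set Hilbert system is a set of rule schemas $\Pi/\Sigma$ ($\Pi,\Sigma$ finite sets of formulas, possibly empty), with all substitution instances as rules. A derivation is a finite rooted tree whose nodes are labelled by sets of formulas or by the symbol $\star$: a non-leaf node labelled $\Lambda$ either has a single child labelled $\star$, provided some rule instance $\Pi/\varnothing$ has $\Pi\subseteq\Lambda$, or has children labelled $\Lambda\cup\{\psi_1\},\dots,\Lambda\cup\{\psi_m\}$ for some rule instance $\Pi/\{\psi_1,\dots,\psi_m\}$ ($m\ge1$) with $\Pi\subseteq\Lambda$. A proof of $(\Gamma,\Delta)$ is a derivation whose root is labelled by a subset of $\Gamma$ and each of whose leaves is labelled $\star$ or by a set meeting $\Delta$; $\Gamma\rhd_{\mathsf R}\Delta$ iff such a proof exists. $\mathsf R$ is $\{p,\neg p\}$-analytic if whenever $\Gamma\rhd_{\mathsf R}\Delta$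 there is a proof of $(\Gamma,\Delta)$ all of whose node labels contain only formulas in $S\cup\{\neg\psi:\psi\in S\}$, where $S$ is the set of subformulas of formulas in $\Gamma\cup\Delta$. $\mathsf{R}_{\mathrm{PWK}}$ has rule schemas: $\varnothing/p,\neg p$; $p/\neg\neg p$; $\neg\neg p/p$; $p,q/p\land q$; $p\land q/p,q$; $p\land q/p,\neg q$; $p\land q/\neg p,q$; $\neg(p\land q)/\neg p,\neg q$; $p,\neg p/p\land q$; $\neg p/\neg(p\land q)$; $q,\neg q/p\land q$; $\neg q/\neg(p\land q)$; $p/p\lor q$; $q/p\lor q$; $p\lor q/p,q$; $\neg(p\lor q)/p,\neg q$; $\neg(p\lor q)/\neg p,q$; $\neg(p\lor q)/\neg p,\neg q$; $p,\neg p/\neg(p\lor q)$; $q,\neg q/\neg(p\lor q)$. *)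

theory Defs
  imports Main "HOL-Library.FSet"
begin

datatype form = Var nat | Neg form | And form form | Or form form

primrec subforms :: "form \<Rightarrow> form set" where
  "subforms (Var x) = {Var x}"
| "subforms (Neg \<phi>) = insert (Neg \<phi>) (subforms \<phi>)"
| "subforms (And \<phi> \<psi>) = insert (And \<phi> \<psi>) (subforms \<phi> \<union> subforms \<psi>)"
| "subforms (Or \<phi> \<psi>) = insert (Or \<phi> \<psi>) (subforms \<phi> \<union> subforms \<psi>)"

primrec subst :: "(nat \<Rightarrow> form) \<Rightarrow> form \<Rightarrow> form" where
  "subst \<sigma> (Var x) = \<sigma> x"
| "subst \<sigma> (Neg \<phi>) = Neg (subst \<sigma> \<phi>)"
| "subst \<sigma> (And \<phi> \<psi>) = And (subst \<sigma> \<phi>) (subst \<sigma> \<psi>)"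
| "subst \<sigma> (Or \<phi> \<psi>) = Or (subst \<sigma> \<phi>) (subst \<sigma> \<psi>)"

datatype tv = ff | uu | tt

definition tv_of_bool :: "bool \<Rightarrow> tv" where
  "tv_of_bool b = (if b then tt else ff)"

definition neg_tv :: "tv \<Rightarrow> tv" where
  "neg_tv a = (if a = uu then uu else tv_of_bool (\<not> a = tt))"

definition and_tv :: "tv \<Rightarrow> tv \<Rightarrow> tv" where
  "and_tv a b = (if a = uu \<or> b = uu then uu else tv_of_bool (a = tt \<and> b = tt))"

definition or_tv :: "tv \<Rightarrow> tv \<Rightarrow> tv" where
  "or_tv a b = (if a = uu \<or> b = uu then uu else tv_of_bool (a = tt \<or> b = tt))"

definition valuation :: "(form \<Rightarrow> tv) \<Rightarrow> bool" where
  "valuation v \<longleftrightarrow>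
     (\<forall>\<phi>. v (Neg \<phi>) = neg_tv (v \<phi>)) \<and>
     (\<forall>\<phi> \<psi>. v (And \<phi> \<psi>) = and_tv (v \<phi>) (v \<psi>)) \<and>
     (\<forall>\<phi> \<psi>. v (Or \<phi> \<psi>) = or_tv (v \<phi>) (v \<psi>))"

definition PWK :: "form set \<Rightarrow> form set \<Rightarrow> bool" where
  "PWK \<Gamma> \<Delta> \<longleftrightarrow> \<not> (\<exists>v. valuation v \<and> v ` \<Gamma> \<subseteq> {uu, tt} \<and> v ` \<Delta> \<subseteq> {ff})"

text \<open>A rule (schema) \<open>\<Pi>/\<Sigma>\<close> is a pair of finite sets of formulas; a Set-Set Hilbert system is a set
  of rule schemas.\<close>

type_synonym rule = "form fset \<times> form fset"

definition instances :: "rule set \<Rightarrow> rule set" where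
  "instances R = {(subst \<sigma> |`| \<Pi>, subst \<sigma> |`| \<Sigma>) | \<sigma> \<Pi> \<Sigma>. (\<Pi>, \<Sigma>) \<in> R}"

datatype 'a rtree = Node (root: 'a) (children: "'a rtree list")

primrec leaf_labels :: "'a rtree \<Rightarrow> 'a set" where
  "leaf_labels (Node l ts) = (if ts = [] then {l} else \<Union> (set (map leaf_labels ts)))"

datatype label = Star | Fms "form set"

text \<open>In \<open>expand\<close>, the list \<open>\<psi>s\<close> enumerates the succedent of a rule instance with nonempty succedent.
  A node labelled \<open>Star\<close> is always a leaf.\<close>

inductive derivation :: "rule set \<Rightarrow> label rtree \<Rightarrow> bool" for R where
  leaf: "derivation R (Node l [])"
| star: "(\<Pi>, {||}) \<in> instances R \<Longrightarrow> fset \<Pi> \<subseteq> \<Lambda>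
     \<Longrightarrow> derivation R (Node (Fms \<Lambda>) [Node Star []])"
| expand: "(\<Pi>, fset_of_list \<psi>s) \<in> instances R \<Longrightarrow> \<psi>s \<noteq> [] \<Longrightarrow> fset \<Pi> \<subseteq> \<Lambda>
     \<Longrightarrow> map root ts = map (\<lambda>\<psi>. Fms (\<Lambda> \<union> {\<psi>})) \<psi>s
     \<Longrightarrow> (\<And>t. t \<in> set ts \<Longrightarrow> derivation R t)
     \<Longrightarrow> derivation R (Node (Fms \<Lambda>) ts)"

definition is_proof :: "rule set \<Rightarrow> form set \<Rightarrow> form set \<Rightarrow> label rtree \<Rightarrow> bool" where
  "is_proof R \<Gamma> \<Delta> t \<longleftrightarrow>
     derivation R t \<and>
     (\<exists>\<Lambda>. root t = Fms \<Lambda> \<and> \<Lambda> \<subseteq> \<Gamma>) \<and>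
     (\<forall>l \<in> leaf_labels t. l = Star \<or> (\<exists>\<Lambda>. l = Fms \<Lambda> \<and> \<Lambda> \<inter> \<Delta> \<noteq> {}))"

definition derives :: "rule set \<Rightarrow> form set \<Rightarrow> form set \<Rightarrow> bool" where
  "derives R \<Gamma> \<Delta> \<longleftrightarrow> (\<exists>t. is_proof R \<Gamma> \<Delta> t)"

text \<open>\<open>{p, \<not>p}\<close>-analyticity; \<open>set_rtree t\<close> is the set of labels of all nodes of \<open>t\<close>.\<close>

definition p_neg_p_analytic :: "rule set \<Rightarrow> bool" where
  "p_neg_p_analytic R \<longleftrightarrow>
     (\<forall>\<Gamma> \<Delta>. derives R \<Gamma> \<Delta> \<longrightarrow>
       (let S = \<Union> (subforms ` (\<Gamma> \<union> \<Delta>))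
        in \<exists>t. is_proof R \<Gamma> \<Delta> t \<and>
             (\<forall>\<Lambda>. Fms \<Lambda> \<in> set_rtree t \<longrightarrow> \<Lambda> \<subseteq> S \<union> {Neg \<psi> | \<psi>. \<psi> \<in> S})))"

definition R_PWK :: "rule set" where
  "R_PWK = (let p = Var 0; q = Var 1 in {
     ({||}, {|p, Neg p|}),
     ({|p|}, {|Neg (Neg p)|}),
     ({|Neg (Neg p)|}, {|p|}),
     ({|p, q|}, {|And p q|}),
     ({|And p q|}, {|p, q|}),
     ({|And p q|}, {|p, Neg q|}),
     ({|And p q|}, {|Neg p, q|}),
     ({|Neg (And p q)|}, {|Neg p, Neg q|}),
     ({|p, Neg p|}, {|And p q|}),
     ({|Neg p|}, {|Neg (And p q)|}),
     ({|q, Neg q|}, {|And p q|}),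
     ({|Neg q|}, {|Neg (And p q)|}),
     ({|p|}, {|Or p q|}),
     ({|q|}, {|Or p q|}),
     ({|Or p q|}, {|p, q|}),
     ({|Neg (Or p q)|}, {|p, Neg q|}),
     ({|Neg (Or p q)|}, {|Neg p, q|}),
     ({|Neg (Or p q)|}, {|Neg p, Neg q|}),
     ({|p, Neg p|}, {|Neg (Or p q)|}),
     ({|q, Neg q|}, {|Neg (Or p q)|})})"

end

theory Submission
  imports Defs
begin

text \<open>For every Set-Set Hilbert system, \<open>(\<Gamma>, \<Delta>)\<close> has a proof inside a set \<open>U \<supseteq> \<Gamma>\<close> of formulas iff
  each subset \<open>T \<supseteq> \<Gamma>\<close> of \<open>U\<close> that is saturated, meaning that it contains some conclusion of each
  rule instance with premises in \<open>T\<close> and conclusions in \<open>U\<close>, meets \<open>\<Delta>\<close>: a maximal set from which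
  \<open>\<Delta>\<close> is not derivable is saturated. The set of formulas designated by a valuation is saturated for
  \<open>U = UNIV\<close>, hence soundness. Conversely, let \<open>T\<close> be saturated for \<open>U = S \<union> \<not>S\<close>. The rules say that
  giving \<open>\<phi>\<close> the value \<open>f\<close> if \<open>\<phi> \<notin> T\<close>, \<open>u\<close> if \<open>\<phi>, \<not>\<phi> \<in> T\<close> and \<open>t\<close> otherwise respects the truth
  tables on \<open>S\<close>, so that PWK-consequences have proofs inside \<open>U\<close>.\<close>

section \<open>Derivability within a set of formulas\<close>

inductive derives_within :: "rule set \<Rightarrow> form set \<Rightarrow> form set \<Rightarrow> form set \<Rightarrow> bool"
  for R :: "rule set" and U :: "form set" where
  overlap: "\<Gamma> \<inter> \<Delta> \<noteq> {} \<Longrightarrow> derives_within R U \<Gamma> \<Delta>"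
| rule_instance: "(\<Pi>, \<Sigma>) \<in> instances R \<Longrightarrow> fset \<Pi> \<subseteq> \<Gamma> \<Longrightarrow> fset \<Sigma> \<subseteq> U
     \<Longrightarrow> (\<And>\<psi>. \<psi> \<in> fset \<Sigma> \<Longrightarrow> derives_within R U (insert \<psi> \<Gamma>) \<Delta>) \<Longrightarrow> derives_within R U \<Gamma> \<Delta>"

lemma derives_within_mono:
  assumes "derives_within R U \<Gamma> \<Delta>" "U \<subseteq> U'" "\<Gamma> \<subseteq> \<Gamma>'" "\<Delta> \<subseteq> \<Delta>'"
  shows "derives_within R U' \<Gamma>' \<Delta>'"
  using assms
proof (induction arbitrary: \<Gamma>' rule: derives_within.induct)
  case (overlap \<Gamma> \<Delta>)
  then show ?case by (blast intro: derives_within.overlap)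
next
  case (rule_instance \<Pi> \<Sigma> \<Gamma> \<Delta>)
  show ?case
  proof (rule derives_within.rule_instance[OF rule_instance.hyps(1)])
    show "fset \<Pi> \<subseteq> \<Gamma>'" "fset \<Sigma> \<subseteq> U'"
      using rule_instance.hyps(2,3) rule_instance.prems(1,2) by auto
    show "derives_within R U' (insert \<psi> \<Gamma>') \<Delta>'" if "\<psi> \<in> fset \<Sigma>" for \<psi>
      by (rule rule_instance.IH[OF that]) (use rule_instance.prems in auto)
  qed
qed

lemma derives_within_finite_premises:
  assumes "derives_within R U \<Gamma> \<Delta>"
  shows "\<exists>\<Gamma>\<^sub>0. finite \<Gamma>\<^sub>0 \<and> \<Gamma>\<^sub>0 \<subseteq> \<Gamma> \<and> derives_within R U \<Gamma>\<^sub>0 \<Delta>"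
  using assms
proof (induction rule: derives_within.induct)
  case (overlap \<Gamma> \<Delta>)
  then obtain \<phi> where "\<phi> \<in> \<Gamma>" "\<phi> \<in> \<Delta>" by blast
  then show ?case by (intro exI[of _ "{\<phi>}"]) (auto intro: derives_within.overlap)
next
  case (rule_instance \<Pi> \<Sigma> \<Gamma> \<Delta>)
  then obtain F where F: "finite (F \<psi>)" "F \<psi> \<subseteq> insert \<psi> \<Gamma>" "derives_within R U (F \<psi>) \<Delta>"
    if "\<psi> \<in> fset \<Sigma>" for \<psi>
    by metis
  define \<Gamma>\<^sub>0 where "\<Gamma>\<^sub>0 = fset \<Pi> \<union> (\<Union>\<psi>\<in>fset \<Sigma>. F \<psi> - {\<psi>})"
  have "derives_within R U \<Gamma>\<^sub>0 \<Delta>"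
  proof (rule derives_within.rule_instance[OF rule_instance.hyps(1) _ rule_instance.hyps(3)])
    show "fset \<Pi> \<subseteq> \<Gamma>\<^sub>0" by (simp add: \<Gamma>\<^sub>0_def)
    fix \<psi> assume \<psi>: "\<psi> \<in> fset \<Sigma>"
    then have "F \<psi> \<subseteq> insert \<psi> \<Gamma>\<^sub>0" by (auto simp: \<Gamma>\<^sub>0_def)
    then show "derives_within R U (insert \<psi> \<Gamma>\<^sub>0) \<Delta>"
      using derives_within_mono[OF F(3)[OF \<psi>]] by blast
  qed
  moreover have "finite \<Gamma>\<^sub>0" using F(1) by (simp add: \<Gamma>\<^sub>0_def)
  moreover have "\<Gamma>\<^sub>0 \<subseteq> \<Gamma>" using F(2) rule_instance.hyps(2) by (auto simp: \<Gamma>\<^sub>0_def)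
  ultimately show ?case by blast
qed

lemma derives_within_Union_chain:
  assumes "\<C> \<noteq> {}" "subset.chain \<A> \<C>" "derives_within R U (\<Union>\<C>) \<Delta>"
  obtains \<Gamma> where "\<Gamma> \<in> \<C>" "derives_within R U \<Gamma> \<Delta>"
proof -
  obtain \<Gamma>\<^sub>0 where \<Gamma>\<^sub>0: "finite \<Gamma>\<^sub>0" "\<Gamma>\<^sub>0 \<subseteq> \<Union>\<C>" "derives_within R U \<Gamma>\<^sub>0 \<Delta>"
    using derives_within_finite_premises[OF assms(3)] by blast
  obtain \<Gamma> where "\<Gamma> \<in> \<C>" "\<Gamma>\<^sub>0 \<subseteq> \<Gamma>"
    using finite_subset_Union_chain[OF \<Gamma>\<^sub>0(1,2) assms(1,2)] .
  with \<Gamma>\<^sub>0(3) show thesis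
    using that derives_within_mono by blast
qed

section \<open>Proof trees\<close>

definition is_proof_within ::
  "rule set \<Rightarrow> form set \<Rightarrow> form set \<Rightarrow> form set \<Rightarrow> label rtree \<Rightarrow> bool" where
  "is_proof_within R U \<Gamma> \<Delta> t \<longleftrightarrow>
     is_proof R \<Gamma> \<Delta> t \<and> (\<forall>\<Lambda>. Fms \<Lambda> \<in> set_rtree t \<longrightarrow> \<Lambda> \<subseteq> U)"

lemma is_proof_within_leaf:
  assumes "\<Gamma> \<inter> \<Delta> \<noteq> {}" "\<Gamma> \<subseteq> U"
  shows "is_proof_within R U \<Gamma> \<Delta> (Node (Fms \<Gamma>) [])"
  using assms by (auto simp: is_proof_within_def is_proof_def intro: derivation.leaf)

lemma is_proof_within_star:
  assumes "(\<Pi>, {||}) \<in> instances R" "fset \<Pi> \<subseteq> \<Gamma>" "\<Gamma> \<subseteq> U"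
  shows "is_proof_within R U \<Gamma> \<Delta> (Node (Fms \<Gamma>) [Node Star []])"
  using assms by (auto simp: is_proof_within_def is_proof_def intro: derivation.star)

lemma is_proof_within_expand:
  assumes "(\<Pi>, fset_of_list \<psi>s) \<in> instances R" "\<psi>s \<noteq> []" "fset \<Pi> \<subseteq> \<Gamma>" "\<Gamma> \<subseteq> U"
    and subproofs: "\<And>\<psi>. \<psi> \<in> set \<psi>s \<Longrightarrow> is_proof_within R U (insert \<psi> \<Gamma>) \<Delta> (t \<psi>)"
    and roots: "\<And>\<psi>. \<psi> \<in> set \<psi>s \<Longrightarrow> root (t \<psi>) = Fms (insert \<psi> \<Gamma>)"
  shows "is_proof_within R U \<Gamma> \<Delta> (Node (Fms \<Gamma>) (map t \<psi>s))"
proof -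
  have "derivation R (Node (Fms \<Gamma>) (map t \<psi>s))"
    using assms(1-3)
  proof (rule derivation.expand)
    show "map root (map t \<psi>s) = map (\<lambda>\<psi>. Fms (\<Gamma> \<union> {\<psi>})) \<psi>s" using roots by simp
    show "derivation R t'" if "t' \<in> set (map t \<psi>s)" for t'
      using that subproofs by (auto simp: is_proof_within_def is_proof_def)
  qed
  with assms(2,4) subproofs show ?thesis
    by (simp add: is_proof_within_def is_proof_def) blast
qed

lemma is_proof_within_child:
  assumes "is_proof_within R U \<Gamma> \<Delta> (Node (Fms \<Lambda>) ts)"
    and "t \<in> set ts" "derivation R t" "root t = Fms (insert \<psi> \<Lambda>)"
  shows "is_proof_within R U (insert \<psi> \<Gamma>) \<Delta> t" "\<psi> \<in> U"
proof -
  have "leaf_labels t \<subseteq> leaf_labels (Node (Fms \<Lambda>) ts)"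
    and "set_rtree t \<subseteq> set_rtree (Node (Fms \<Lambda>) ts)"
    using assms(2) by auto
  moreover have "insert \<psi> \<Lambda> \<subseteq> insert \<psi> \<Gamma>"
    using assms(1) by (auto simp: is_proof_within_def is_proof_def)
  ultimately show "is_proof_within R U (insert \<psi> \<Gamma>) \<Delta> t"
    using assms(1,3,4) unfolding is_proof_within_def is_proof_def by (meson subsetD)
  moreover have "Fms (insert \<psi> \<Lambda>) \<in> set_rtree t"
    using assms(4) by (metis rtree.set_sel(1))
  ultimately show "\<psi> \<in> U"
    unfolding is_proof_within_def by blast
qed

lemma is_proof_within_if_derives_within:
  assumes "derives_within R U \<Gamma> \<Delta>" "\<Gamma> \<subseteq> U"
  shows "\<exists>t. is_proof_within R U \<Gamma> \<Delta> t \<and> root t = Fms \<Gamma>"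
  using assms
proof (induction rule: derives_within.induct)
  case (overlap \<Gamma> \<Delta>)
  then show ?case by (meson is_proof_within_leaf rtree.sel(1))
next
  case (rule_instance \<Pi> \<Sigma> \<Gamma> \<Delta>)
  show ?case
  proof (cases "\<Sigma> = {||}")
    case True
    with rule_instance show ?thesis by (meson is_proof_within_star rtree.sel(1))
  next
    case False
    obtain \<psi>s where \<psi>s: "fset_of_list \<psi>s = \<Sigma>"
      using exists_fset_of_list by blast
    then have "fset \<Sigma> = set \<psi>s" by (auto simp: fset_of_list.rep_eq)
    with rule_instance.IH rule_instance.hyps(3) rule_instance.prems
    obtain t where "is_proof_within R U (insert \<psi> \<Gamma>) \<Delta> (t \<psi>)" "root (t \<psi>) = Fms (insert \<psi> \<Gamma>)"
      if "\<psi> \<in> set \<psi>s" for \<psi>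
      by (metis insert_subset subsetD)
    then have "is_proof_within R U \<Gamma> \<Delta> (Node (Fms \<Gamma>) (map t \<psi>s))"
      using rule_instance.hyps(1,2) rule_instance.prems \<psi>s False
      by (intro is_proof_within_expand) auto
    then show ?thesis by (meson rtree.sel(1))
  qed
qed

lemma derives_within_if_is_proof_within:
  assumes "is_proof_within R U \<Gamma> \<Delta> t"
  shows "derives_within R U \<Gamma> \<Delta>"
proof -
  have "derivation R t"
    using assms by (simp add: is_proof_within_def is_proof_def)
  then show ?thesis
    using assms
  proof (induction arbitrary: \<Gamma> rule: derivation.induct)
    case (leaf l)
    then have "\<Gamma> \<inter> \<Delta> \<noteq> {}"
      by (auto simp: is_proof_within_def is_proof_def)
    then show ?case by (rule derives_within.overlap)
  next
    case (star \<Pi> \<Lambda>)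
    then have "fset \<Pi> \<subseteq> \<Gamma>" by (auto simp: is_proof_within_def is_proof_def)
    with star.hyps(1) show ?case by (rule derives_within.rule_instance) simp_all
  next
    case (expand \<Pi> \<psi>s \<Lambda> ts)
    have "\<Lambda> \<subseteq> \<Gamma>"
      using expand.prems by (simp add: is_proof_within_def is_proof_def)
    have branch: "\<psi> \<in> U" "derives_within R U (insert \<psi> \<Gamma>) \<Delta>" if \<psi>: "\<psi> \<in> set \<psi>s" for \<psi>
    proof -
      have "Fms (\<Lambda> \<union> {\<psi>}) \<in> set (map root ts)"
        using \<psi> by (auto simp: expand.hyps(4))
      then obtain t where t: "t \<in> set ts" "root t = Fms (insert \<psi> \<Lambda>)" by auto
      with expand.prems expand.hyps(5) show "\<psi> \<in> U" "derives_within R U (insert \<psi> \<Gamma>) \<Delta>"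
        using is_proof_within_child expand.IH by blast+
    qed
    show ?case
      using expand.hyps(1)
      by (rule derives_within.rule_instance)
        (use expand.hyps(3) \<open>\<Lambda> \<subseteq> \<Gamma>\<close> branch in \<open>auto simp: fset_of_list.rep_eq\<close>)
  qed
qed

lemma derives_within_iff_is_proof_within:
  assumes "\<Gamma> \<subseteq> U"
  shows "derives_within R U \<Gamma> \<Delta> \<longleftrightarrow> (\<exists>t. is_proof_within R U \<Gamma> \<Delta> t)"
  using is_proof_within_if_derives_within[OF _ assms] derives_within_if_is_proof_within by blast

lemma derives_iff_derives_within_UNIV: "derives R \<Gamma> \<Delta> \<longleftrightarrow> derives_within R UNIV \<Gamma> \<Delta>"
  by (simp add: derives_within_iff_is_proof_within is_proof_within_def derives_def)

section \<open>Saturated sets\<close>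

definition saturated :: "rule set \<Rightarrow> form set \<Rightarrow> form set \<Rightarrow> bool" where
  "saturated R U T \<longleftrightarrow> (\<forall>(\<Pi>, \<Sigma>)\<in>instances R.
     fset \<Pi> \<subseteq> T \<longrightarrow> fset \<Sigma> \<subseteq> U \<longrightarrow> (\<exists>\<psi>\<in>fset \<Sigma>. \<psi> \<in> T))"

lemma saturated_iff_schemas:
  "saturated R U T \<longleftrightarrow> (\<forall>\<sigma>. \<forall>(\<Pi>, \<Sigma>)\<in>R.
     (\<forall>\<phi>\<in>fset \<Pi>. subst \<sigma> \<phi> \<in> T) \<longrightarrow> (\<forall>\<psi>\<in>fset \<Sigma>. subst \<sigma> \<psi> \<in> U) \<longrightarrow>
     (\<exists>\<psi>\<in>fset \<Sigma>. subst \<sigma> \<psi> \<in> T))"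
proof -
  have "instances R = (\<Union>\<sigma>. map_prod (fimage (subst \<sigma>)) (fimage (subst \<sigma>)) ` R)"
    unfolding instances_def by force
  then show ?thesis
    by (simp add: saturated_def case_prod_beta image_subset_iff)
qed

lemma derives_within_meets_saturated:
  assumes "derives_within R U \<Gamma> \<Delta>" "saturated R U T" "\<Gamma> \<subseteq> T"
  shows "T \<inter> \<Delta> \<noteq> {}"
  using assms
proof (induction rule: derives_within.induct)
  case (overlap \<Gamma> \<Delta>)
  then show ?case by blast
next
  case (rule_instance \<Pi> \<Sigma> \<Gamma> \<Delta>)
  have "fset \<Pi> \<subseteq> T" using rule_instance.hyps(2) rule_instance.prems(2) by blast
  then obtain \<psi> where "\<psi> \<in> fset \<Sigma>" "\<psi> \<in> T"
    using rule_instance.hyps(1,3) rule_instance.prems(1) by (fastforce simp: saturated_def)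
  with rule_instance.IH rule_instance.prems show ?case by simp
qed

lemma maximal_underivable_saturated:
  assumes "\<not> derives_within R U T \<Delta>"
    and maximal: "\<And>\<psi>. \<psi> \<in> U - T \<Longrightarrow> derives_within R U (insert \<psi> T) \<Delta>"
  shows "saturated R U T"
  unfolding saturated_def
proof (clarify, rule ccontr)
  fix \<Pi> \<Sigma>
  assume "(\<Pi>, \<Sigma>) \<in> instances R" "fset \<Pi> \<subseteq> T" "fset \<Sigma> \<subseteq> U"
    and "\<not> (\<exists>\<psi>\<in>fset \<Sigma>. \<psi> \<in> T)"
  then have "derives_within R U T \<Delta>"
    using maximal by (blast intro: derives_within.rule_instance)
  with assms(1) show False by contradiction
qed

lemma underivable_extends_to_saturated:
  assumes "\<Gamma> \<subseteq> U" "\<not> derives_within R U \<Gamma> \<Delta>"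
  obtains T where "saturated R U T" "\<Gamma> \<subseteq> T" "T \<subseteq> U" "T \<inter> \<Delta> = {}"
proof -
  define \<A> where "\<A> = {T. \<Gamma> \<subseteq> T \<and> T \<subseteq> U \<and> \<not> derives_within R U T \<Delta>}"
  have "\<exists>T\<in>\<A>. \<forall>X\<in>\<A>. T \<subseteq> X \<longrightarrow> X = T"
  proof (rule subset_Zorn_nonempty)
    show "\<A> \<noteq> {}" using assms by (auto simp: \<A>_def)
    fix \<C> assume \<C>: "\<C> \<noteq> {}" "subset.chain \<A> \<C>"
    have "\<C> \<subseteq> \<A>" using \<C>(2) by (simp add: subset.chain_def)
    have "\<not> derives_within R U (\<Union>\<C>) \<Delta>"
    proof
      assume "derives_within R U (\<Union>\<C>) \<Delta>"
      with \<C> obtain T where "T \<in> \<C>" "derives_within R U T \<Delta>"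
        by (rule derives_within_Union_chain)
      with \<open>\<C> \<subseteq> \<A>\<close> show False by (auto simp: \<A>_def)
    qed
    moreover have "\<Gamma> \<subseteq> \<Union>\<C>" "\<Union>\<C> \<subseteq> U"
      using \<open>\<C> \<noteq> {}\<close> \<open>\<C> \<subseteq> \<A>\<close> by (auto simp: \<A>_def)
    ultimately show "\<Union>\<C> \<in> \<A>" by (simp add: \<A>_def)
  qed
  then obtain T where "T \<in> \<A>" and maximal: "\<And>X. X \<in> \<A> \<Longrightarrow> T \<subseteq> X \<Longrightarrow> X = T" by blast
  then have T: "\<Gamma> \<subseteq> T" "T \<subseteq> U" "\<not> derives_within R U T \<Delta>" by (simp_all add: \<A>_def)
  have "derives_within R U (insert \<psi> T) \<Delta>" if "\<psi> \<in> U - T" for \<psi>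
    using maximal[of "insert \<psi> T"] that T(1,2) by (auto simp: \<A>_def)
  with T(3) have "saturated R U T" by (rule maximal_underivable_saturated)
  moreover have "T \<inter> \<Delta> = {}" using T(3) derives_within.overlap by blast
  ultimately show thesis using that T(1,2) by blast
qed

lemma derives_within_iff_saturated:
  assumes "\<Gamma> \<subseteq> U"
  shows "derives_within R U \<Gamma> \<Delta> \<longleftrightarrow>
    (\<forall>T. saturated R U T \<longrightarrow> \<Gamma> \<subseteq> T \<longrightarrow> T \<subseteq> U \<longrightarrow> T \<inter> \<Delta> \<noteq> {})"
proof
  assume "derives_within R U \<Gamma> \<Delta>"
  then show "\<forall>T. saturated R U T \<longrightarrow> \<Gamma> \<subseteq> T \<longrightarrow> T \<subseteq> U \<longrightarrow> T \<inter> \<Delta> \<noteq> {}"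
    using derives_within_meets_saturated by blast
next
  assume "\<forall>T. saturated R U T \<longrightarrow> \<Gamma> \<subseteq> T \<longrightarrow> T \<subseteq> U \<longrightarrow> T \<inter> \<Delta> \<noteq> {}"
  then show "derives_within R U \<Gamma> \<Delta>"
    using underivable_extends_to_saturated[OF assms] by metis
qed

section \<open>Soundness\<close>

definition designated :: "(form \<Rightarrow> tv) \<Rightarrow> form set" where
  "designated v = {\<phi>. v \<phi> \<noteq> ff}"

lemma PWK_iff_designated:
  "PWK \<Gamma> \<Delta> \<longleftrightarrow> (\<forall>v. valuation v \<longrightarrow> \<Gamma> \<subseteq> designated v \<longrightarrow> designated v \<inter> \<Delta> \<noteq> {})"
proof -
  have "v ` \<Gamma> \<subseteq> {uu, tt} \<longleftrightarrow> \<Gamma> \<subseteq> designated v" for v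
    using tv.exhaust by (auto simp: designated_def)
  moreover have "v ` \<Delta> \<subseteq> {ff} \<longleftrightarrow> designated v \<inter> \<Delta> = {}" for v
    by (auto simp: designated_def)
  ultimately show ?thesis by (auto simp: PWK_def)
qed

lemma valuation_subst: "valuation v \<Longrightarrow> valuation (v \<circ> subst \<sigma>)"
  by (simp add: valuation_def)

lemma saturated_designated:
  assumes "\<forall>(\<Pi>, \<Sigma>)\<in>R. PWK (fset \<Pi>) (fset \<Sigma>)" "valuation v"
  shows "saturated R U (designated v)"
  unfolding saturated_iff_schemas
proof clarify
  fix \<sigma> \<Pi> \<Sigma>
  assume "(\<Pi>, \<Sigma>) \<in> R" "\<forall>\<phi>\<in>fset \<Pi>. subst \<sigma> \<phi> \<in> designated v"
  then have "PWK (fset \<Pi>) (fset \<Sigma>)" "fset \<Pi> \<subseteq> designated (v \<circ> subst \<sigma>)"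
    using assms(1) by (auto simp: designated_def)
  then have "designated (v \<circ> subst \<sigma>) \<inter> fset \<Sigma> \<noteq> {}"
    using valuation_subst[OF assms(2)] by (simp add: PWK_iff_designated)
  then show "\<exists>\<psi>\<in>fset \<Sigma>. subst \<sigma> \<psi> \<in> designated v" by (auto simp: designated_def)
qed

lemma derives_imp_PWK:
  assumes "\<forall>(\<Pi>, \<Sigma>)\<in>R. PWK (fset \<Pi>) (fset \<Sigma>)" "derives R \<Gamma> \<Delta>"
  shows "PWK \<Gamma> \<Delta>"
  unfolding PWK_iff_designated
proof (intro allI impI)
  fix v
  assume "valuation v" "\<Gamma> \<subseteq> designated v"
  moreover have "derives_within R UNIV \<Gamma> \<Delta>"
    using assms(2) by (simp add: derives_iff_derives_within_UNIV)
  ultimately show "designated v \<inter> \<Delta> \<noteq> {}"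
    using derives_within_meets_saturated saturated_designated[OF assms(1)] by metis
qed

lemma R_PWK_sound: "\<forall>(\<Pi>, \<Sigma>)\<in>R_PWK. PWK (fset \<Pi>) (fset \<Sigma>)"
proof -
  have "\<forall>(\<Pi>, \<Sigma>)\<in>R_PWK. fset \<Pi> \<subseteq> designated v \<longrightarrow> designated v \<inter> fset \<Sigma> \<noteq> {}"
    if "valuation v" for v
    using that
    by (cases "v (Var 0)"; cases "v (Var 1)")
      (simp_all add: R_PWK_def Let_def designated_def valuation_def
        neg_tv_def and_tv_def or_tv_def tv_of_bool_def)
  then show ?thesis by (simp add: PWK_iff_designated case_prod_beta)
qed

section \<open>Analytic completeness\<close>

definition neg_closure :: "form set \<Rightarrow> form set" where
  "neg_closure S = S \<union> {Neg \<psi> |\<psi>. \<psi> \<in> S}"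

lemma in_neg_closure:
  assumes "\<phi> \<in> S"
  shows "\<phi> \<in> neg_closure S \<and> Neg \<phi> \<in> neg_closure S"
  using assms by (auto simp: neg_closure_def)

lemma subforms_refl: "\<phi> \<in> subforms \<phi>"
  by (cases \<phi>) auto

lemma subset_neg_closure:
  assumes "\<And>\<phi>. \<phi> \<in> \<Gamma> \<Longrightarrow> subforms \<phi> \<subseteq> S"
  shows "\<Gamma> \<subseteq> neg_closure S"
proof
  fix \<phi> assume "\<phi> \<in> \<Gamma>"
  then have "\<phi> \<in> S" using assms subforms_refl by auto
  then show "\<phi> \<in> neg_closure S" by (simp add: in_neg_closure)
qed

context
  fixes S T :: "form set"
  assumes saturated: "saturated R_PWK (neg_closure S) T"
begin

lemma saturated_R_PWK_instance:
  fixes p q :: form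
  defines "\<sigma> \<equiv> \<lambda>n. if n = 0 then p else q"
  shows "\<forall>(\<Pi>, \<Sigma>)\<in>R_PWK. (\<forall>\<phi>\<in>fset \<Pi>. subst \<sigma> \<phi> \<in> T) \<longrightarrow>
    (\<forall>\<psi>\<in>fset \<Sigma>. subst \<sigma> \<psi> \<in> neg_closure S) \<longrightarrow> (\<exists>\<psi>\<in>fset \<Sigma>. subst \<sigma> \<psi> \<in> T)"
  using saturated unfolding saturated_iff_schemas by (rule spec)

lemmas saturated_R_PWK_rules = saturated_R_PWK_instance[unfolded R_PWK_def Let_def, simplified]

lemma saturated_excluded_middle:
  assumes "p \<in> S"
  shows "p \<in> T \<or> Neg p \<in> T"
  using saturated_R_PWK_rules[of p p] in_neg_closure[OF assms] by argo

lemma saturated_Neg_Neg_iff: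
  assumes "p \<in> S" "Neg p \<in> S"
  shows "Neg (Neg p) \<in> T \<longleftrightarrow> p \<in> T"
  using saturated_R_PWK_rules[of p p] assms[THEN in_neg_closure] by argo

lemma saturated_And_iff:
  assumes "p \<in> S" "q \<in> S" "And p q \<in> S"
  shows "And p q \<in> T \<longleftrightarrow>
    p \<in> T \<and> q \<in> T \<or> p \<in> T \<and> Neg p \<in> T \<or> q \<in> T \<and> Neg q \<in> T"
  using saturated_R_PWK_rules[of p q] assms[THEN in_neg_closure] by argo

lemma saturated_Neg_And_iff:
  assumes "p \<in> S" "q \<in> S" "And p q \<in> S"
  shows "Neg (And p q) \<in> T \<longleftrightarrow> Neg p \<in> T \<or> Neg q \<in> T"
  using saturated_R_PWK_rules[of p q] assms[THEN in_neg_closure] by argo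

lemma saturated_Or_iff:
  assumes "p \<in> S" "q \<in> S" "Or p q \<in> S"
  shows "Or p q \<in> T \<longleftrightarrow> p \<in> T \<or> q \<in> T"
  using saturated_R_PWK_rules[of p q] assms[THEN in_neg_closure] by argo

text \<open>There is no rule \<open>\<not>p, \<not>q / \<not>(p \<or> q)\<close>: excluded middle for \<open>p \<or> q\<close> stands in for it.\<close>

lemma saturated_Neg_Or_iff:
  assumes "p \<in> S" "q \<in> S" "Or p q \<in> S"
  shows "Neg (Or p q) \<in> T \<longleftrightarrow>
    Neg p \<in> T \<and> Neg q \<in> T \<or> p \<in> T \<and> Neg p \<in> T \<or> q \<in> T \<and> Neg q \<in> T"
  using saturated_R_PWK_rules[of p q] assms[THEN in_neg_closure]
    saturated_excluded_middle[OF assms(3)] saturated_Or_iff[OF assms]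
  by argo

end

definition membership_tv :: "form set \<Rightarrow> form \<Rightarrow> tv" where
  "membership_tv T \<phi> = (if \<phi> \<notin> T then ff else if Neg \<phi> \<in> T then uu else tt)"

lemma valuation_eq_membership_tv:
  assumes v: "valuation v" "\<And>x. v (Var x) = membership_tv T (Var x)"
    and T: "saturated R_PWK (neg_closure S) T"
    and "subforms \<phi> \<subseteq> S"
  shows "v \<phi> = membership_tv T \<phi>"
  using assms(4)
proof (induction \<phi>)
  case (Var x)
  show ?case by (rule v(2))
next
  case (Neg p)
  then have "p \<in> S" "Neg p \<in> S" using subforms_refl by auto
  then have "neg_tv (membership_tv T p) = membership_tv T (Neg p)"
    using saturated_excluded_middle[OF T] saturated_Neg_Neg_iff[OF T]
    by (auto simp: membership_tv_def neg_tv_def tv_of_bool_def)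
  with Neg v(1) show ?case by (simp add: valuation_def)
next
  case (And p q)
  then have "p \<in> S" "q \<in> S" "And p q \<in> S" using subforms_refl by auto
  then have "and_tv (membership_tv T p) (membership_tv T q) = membership_tv T (And p q)"
    using saturated_excluded_middle[OF T, of p] saturated_excluded_middle[OF T, of q]
    by (auto simp: saturated_And_iff[OF T] saturated_Neg_And_iff[OF T]
        membership_tv_def and_tv_def tv_of_bool_def)
  with And v(1) show ?case by (simp add: valuation_def)
next
  case (Or p q)
  then have "p \<in> S" "q \<in> S" "Or p q \<in> S" using subforms_refl by auto
  then have "or_tv (membership_tv T p) (membership_tv T q) = membership_tv T (Or p q)"
    using saturated_excluded_middle[OF T, of p] saturated_excluded_middle[OF T, of q]
    by (auto simp: saturated_Or_iff[OF T] saturated_Neg_Or_iff[OF T]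
        membership_tv_def or_tv_def tv_of_bool_def)
  with Or v(1) show ?case by (simp add: valuation_def)
qed

primrec eval_form :: "(nat \<Rightarrow> tv) \<Rightarrow> form \<Rightarrow> tv" where
  "eval_form e (Var x) = e x"
| "eval_form e (Neg \<phi>) = neg_tv (eval_form e \<phi>)"
| "eval_form e (And \<phi> \<psi>) = and_tv (eval_form e \<phi>) (eval_form e \<psi>)"
| "eval_form e (Or \<phi> \<psi>) = or_tv (eval_form e \<phi>) (eval_form e \<psi>)"

lemma valuation_eval_form: "valuation (eval_form e)"
  by (simp add: valuation_def)

lemma PWK_imp_derives_within_neg_closure:
  assumes "PWK \<Gamma> \<Delta>" and S: "\<And>\<phi>. \<phi> \<in> \<Gamma> \<union> \<Delta> \<Longrightarrow> subforms \<phi> \<subseteq> S"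
  shows "derives_within R_PWK (neg_closure S) \<Gamma> \<Delta>"
proof -
  have "T \<inter> \<Delta> \<noteq> {}" if T: "saturated R_PWK (neg_closure S) T" and "\<Gamma> \<subseteq> T" for T
  proof -
    define v where "v = eval_form (\<lambda>x. membership_tv T (Var x))"
    have "valuation v" by (simp add: v_def valuation_eval_form)
    have designated_iff: "\<phi> \<in> designated v \<longleftrightarrow> \<phi> \<in> T" if "\<phi> \<in> \<Gamma> \<union> \<Delta>" for \<phi>
    proof -
      have "v \<phi> = membership_tv T \<phi>"
        using \<open>valuation v\<close> _ T S[OF that]
        by (rule valuation_eq_membership_tv) (simp add: v_def)
      then show ?thesis by (simp add: designated_def membership_tv_def)
    qed
    then have "\<Gamma> \<subseteq> designated v" using \<open>\<Gamma> \<subseteq> T\<close> by auto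
    then have "designated v \<inter> \<Delta> \<noteq> {}"
      using assms(1) \<open>valuation v\<close> by (simp add: PWK_iff_designated)
    with designated_iff show ?thesis by auto
  qed
  moreover have "\<Gamma> \<subseteq> neg_closure S"
    using S by (intro subset_neg_closure) simp
  ultimately show ?thesis by (simp add: derives_within_iff_saturated)
qed

lemma p_neg_p_analytic_iff:
  "p_neg_p_analytic R \<longleftrightarrow> (\<forall>\<Gamma> \<Delta>. derives R \<Gamma> \<Delta> \<longrightarrow>
     derives_within R (neg_closure (\<Union> (subforms ` (\<Gamma> \<union> \<Delta>)))) \<Gamma> \<Delta>)"
proof -
  have "\<Gamma> \<subseteq> neg_closure (\<Union> (subforms ` (\<Gamma> \<union> \<Delta>)))" for \<Gamma> \<Delta>
    by (rule subset_neg_closure) blast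
  then show ?thesis
    by (simp add: p_neg_p_analytic_def Let_def derives_within_iff_is_proof_within
        is_proof_within_def flip: neg_closure_def)
qed

theorem theorem4:
  "p_neg_p_analytic R_PWK \<and> derives R_PWK = PWK"
proof
  have complete: "derives_within R_PWK (neg_closure (\<Union> (subforms ` (\<Gamma> \<union> \<Delta>)))) \<Gamma> \<Delta>"
    if "PWK \<Gamma> \<Delta>" for \<Gamma> \<Delta>
    using that by (rule PWK_imp_derives_within_neg_closure) blast
  show "p_neg_p_analytic R_PWK"
    unfolding p_neg_p_analytic_iff using derives_imp_PWK[OF R_PWK_sound] complete by blast
  have "derives R_PWK \<Gamma> \<Delta>" if "PWK \<Gamma> \<Delta>" for \<Gamma> \<Delta>
    unfolding derives_iff_derives_within_UNIV
    using complete[OF that] by (rule derives_within_mono) simp_all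
  then show "derives R_PWK = PWK"
    by (intro ext iffI derives_imp_PWK[OF R_PWK_sound])
qed

end
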